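(* For any Boolean matrices $K \in \{0,1\}^{m_1\times n_1}$ and $M \in \{0,1\}^{m_2\times n_2}$, we have $\mathsf{OR}(K \otimes M) \ge \mathsf{rk_\lor^*}(K) \cdot \mathsf{OR}(M)$.
   Context: The Kronecker product $K\otimes M$ is the $(m_1m_2)\times(n_1n_2)$ Boolean matrix with rows indexed by pairs $(i_1,i_2)$, columns by pairs $(j_1,j_2)$, and entry $K_{i_1,j_1}\cdot M_{i_2,j_2}$. A rectifier network with $m$ inputs and $n$ outputs is a tuple $(V,E,\mathsf{in},\mathsf{out})$ where $(V,E)$ is a directed acyclic graph and $\mathsf{in}\colon\{1,\dots,n\}\to V$, $\mathsf{out}\colon\{1,\dots,m\}\to V$ are injective maps whose images consist only of sources (respectively, only of sinks); its size is $|E|$; it expresses the Boolean $m\times n$ matrix with entry $(i,j)$ equal to $1$ iff there is a directed path from $\mathsf{in}(j)$ to $\mathsf{out}(i)$. $\mathsf{OR}(A)$ is the smallest size of any rectifier network expressing $A$. A 1-rectangle of $K$ is a pair $(R,C)$ of a set of row indices and a set of column indices with $K_{ij}=1$ for all $(i,j)\in R\times C$. The fractional rank $\mathsf{rk_\lor^*}(K)$ is the optimal value of the linear program: minimize $\sum_{(R,C)} x_{(R,C)}$ over real $x_{(R,C)}\in[0,1]$ indexed by the 1-rectangles of $K$, subject to $\sum_{(R,C)\ni(i,j)} x_{(R,C)} \ge 1$ for every $(i,j)$ with $K_{ij}=1$. *)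

theory Defs
  imports Complex_Main
begin

text \<open>
  A Boolean matrix with finite row index set \<open>I\<close> and finite column index set \<open>J\<close> is a function
  \<open>A\<close> with entries \<open>A i j\<close>; only the entries with \<open>i \<in> I\<close> and \<open>j \<in> J\<close> matter. The index sets are
  explicit so that the rows and columns of a Kronecker product can be indexed by pairs.
\<close>

definition kronecker ::
  "('i1 \<Rightarrow> 'j1 \<Rightarrow> bool) \<Rightarrow> ('i2 \<Rightarrow> 'j2 \<Rightarrow> bool) \<Rightarrow> 'i1 \<times> 'i2 \<Rightarrow> 'j1 \<times> 'j2 \<Rightarrow> bool"
  where "kronecker K M = (\<lambda>(i1, i2) (j1, j2). K i1 j1 \<and> M i2 j2)"

text \<open>
  Columns are inputs and rows are outputs. An isolated vertex is both a source and a sink, so the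
  images of \<open>inp\<close> and \<open>out\<close> are allowed to overlap.
\<close>

definition rectifier_network ::
  "'i set \<Rightarrow> 'j set \<Rightarrow> 'v set \<Rightarrow> ('v \<times> 'v) set \<Rightarrow> ('j \<Rightarrow> 'v) \<Rightarrow> ('i \<Rightarrow> 'v) \<Rightarrow> bool"
  where "rectifier_network I J V E inp out \<longleftrightarrow>
    finite V \<and> E \<subseteq> V \<times> V \<and> acyclic E \<and>
    inj_on inp J \<and> inp ` J \<subseteq> V - Range E \<and>
    inj_on out I \<and> out ` I \<subseteq> V - Domain E"

text \<open>Directed paths may have length 0, hence the reflexive closure.\<close>

definition expresses ::
  "'i set \<Rightarrow> 'j set \<Rightarrow> ('v \<times> 'v) set \<Rightarrow> ('j \<Rightarrow> 'v) \<Rightarrow> ('i \<Rightarrow> 'v) \<Rightarrow> ('i \<Rightarrow> 'j \<Rightarrow> bool) \<Rightarrow> bool"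
  where "expresses I J E inp out A \<longleftrightarrow>
    (\<forall>i\<in>I. \<forall>j\<in>J. A i j \<longleftrightarrow> (inp j, out i) \<in> E\<^sup>*)"

text \<open>
  Networks are finite, so taking their vertices from \<^typ>\<open>nat\<close> covers all of them up to
  isomorphism. For finite index sets some network exists (\<open>ex_network\<close> below), so the
  \<open>LEAST\<close> is attained.
\<close>

definition OR_complexity :: "'i set \<Rightarrow> 'j set \<Rightarrow> ('i \<Rightarrow> 'j \<Rightarrow> bool) \<Rightarrow> nat"
  where "OR_complexity I J A = (LEAST s. \<exists>(V :: nat set) E inp out.
    rectifier_network I J V E inp out \<and> expresses I J E inp out A \<and> s = card E)"

definition one_rectangles :: "'i set \<Rightarrow> 'j set \<Rightarrow> ('i \<Rightarrow> 'j \<Rightarrow> bool) \<Rightarrow> ('i set \<times> 'j set) set"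
  where "one_rectangles I J K =
    {(R, C). R \<subseteq> I \<and> C \<subseteq> J \<and> (\<forall>i\<in>R. \<forall>j\<in>C. K i j)}"

definition fractional_cover ::
  "'i set \<Rightarrow> 'j set \<Rightarrow> ('i \<Rightarrow> 'j \<Rightarrow> bool) \<Rightarrow> ('i set \<times> 'j set \<Rightarrow> real) \<Rightarrow> bool"
  where "fractional_cover I J K x \<longleftrightarrow>
    (\<forall>r \<in> one_rectangles I J K. 0 \<le> x r \<and> x r \<le> 1) \<and>
    (\<forall>i\<in>I. \<forall>j\<in>J. K i j \<longrightarrow>
      (\<Sum>r \<in> {(R, C) \<in> one_rectangles I J K. i \<in> R \<and> j \<in> C}. x r) \<ge> 1)"

definition fractional_rank :: "'i set \<Rightarrow> 'j set \<Rightarrow> ('i \<Rightarrow> 'j \<Rightarrow> bool) \<Rightarrow> real"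
  where "fractional_rank I J K =
    Inf {(\<Sum>r \<in> one_rectangles I J K. x r) | x. fractional_cover I J K x}"

lemma ex_network:
  assumes "finite I" "finite J"
  shows "\<exists>(V :: nat set) E inp out.
    rectifier_network I J V E inp out \<and> expresses I J E inp out A"
proof -
  obtain f :: "'b \<Rightarrow> nat" where f: "inj_on f J"
    using finite_imp_inj_to_nat_seg[OF assms(2)] by blast
  obtain g :: "'a \<Rightarrow> nat" where g: "inj_on g I"
    using finite_imp_inj_to_nat_seg[OF assms(1)] by blast
  define inp where "inp j = 2 * f j" for j
  define out where "out i = 2 * g i + 1" for i
  define E where "E = {(inp j, out i) | i j. i \<in> I \<and> j \<in> J \<and> A i j}"
  have par: "even u \<and> odd v" if "(u, v) \<in> E" for u v
    using that by (auto simp: E_def inp_def out_def)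
  have "trans E" by (rule transI) (use par in blast)
  then have tc: "E\<^sup>+ = E" by (rule trancl_id)
  then have rt: "E\<^sup>* = E \<union> Id" by (simp only: rtrancl_trancl_reflcl)
  have "acyclic E"
    unfolding acyclic_def tc using par by blast
  have inj: "inj_on inp J" "inj_on out I"
    using f g by (auto simp: inj_on_def inp_def out_def)
  have ne: "inp j \<noteq> out i" for i j
    unfolding inp_def out_def by presburger
  have "rectifier_network I J (inp ` J \<union> out ` I) E inp out"
    unfolding rectifier_network_def using assms inj \<open>acyclic E\<close>
    by (auto simp: E_def ne dest: ne[THEN notE, OF sym])
  moreover have "expresses I J E inp out A"
    unfolding expresses_def rt using inj ne by (auto simp: E_def inj_on_def)
  ultimately show ?thesis by blast
qed

lemma OR_complexity_attained:
  assumes "finite I" "finite J"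
  shows "\<exists>(V :: nat set) E inp out. rectifier_network I J V E inp out \<and>
    expresses I J E inp out A \<and> OR_complexity I J A = card E"
proof -
  let ?P = "\<lambda>s. \<exists>(V :: nat set) E inp out.
    rectifier_network I J V E inp out \<and> expresses I J E inp out A \<and> s = card E"
  have "\<exists>s. ?P s" using ex_network[OF assms, of A] by blast
  then have "?P (LEAST s. ?P s)" by (rule LeastI_ex)
  then show ?thesis by (simp only: OR_complexity_def)
qed

lemma finite_one_rectangles:
  assumes "finite I" "finite J"
  shows "finite (one_rectangles I J K)"
  by (rule finite_subset[of _ "Pow I \<times> Pow J"]) (auto simp: one_rectangles_def assms)

lemma fractional_cover_one:
  assumes "finite I" "finite J"
  shows "fractional_cover I J K (\<lambda>_. 1)"
proof -
  have "(\<Sum>r \<in> {(R, C) \<in> one_rectangles I J K. i \<in> R \<and> j \<in> C}. 1 :: real) \<ge> 1"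
    if "i \<in> I" "j \<in> J" "K i j" for i j
  proof -
    let ?S = "{(R, C) \<in> one_rectangles I J K. i \<in> R \<and> j \<in> C}"
    have "finite ?S"
      by (rule finite_subset[OF _ finite_one_rectangles[OF assms]]) blast
    moreover have "({i}, {j}) \<in> ?S" using that by (auto simp: one_rectangles_def)
    ultimately have "card ?S > 0" by (subst card_gt_0_iff) blast
    then have "card ?S \<ge> 1" by linarith
    then show ?thesis by simp
  qed
  then show ?thesis unfolding fractional_cover_def by simp
qed

end

theory Submission
  imports Defs
begin

text \<open>
  Take an optimal network for \<open>K \<otimes> M\<close>. For a 1-entry \<open>(i, j)\<close> of \<open>K\<close>, the edges lying on a path
  from some input \<open>(j, _)\<close> to some output \<open>(i, _)\<close> form a network for \<open>M\<close>, so there are at least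
  \<open>OR(M)\<close> of them. Conversely, the entries \<open>(i, j)\<close> that use a given edge form a 1-rectangle of \<open>K\<close>.
  Giving each rectangle the number of edges that induce it, divided by \<open>OR(M)\<close>, is thus a
  fractional cover of \<open>K\<close> of total weight \<open>OR(K \<otimes> M) / OR(M)\<close>.
\<close>

lemma OR_complexity_le_card:
  fixes V :: "nat set"
  assumes "rectifier_network I J V E inp out" "expresses I J E inp out A"
  shows "OR_complexity I J A \<le> card E"
  unfolding OR_complexity_def by (rule Least_le) (use assms in blast)

lemma fractional_rank_le:
  assumes "fractional_cover I J K x"
  shows "fractional_rank I J K \<le> (\<Sum>r \<in> one_rectangles I J K. x r)"
  unfolding fractional_rank_def
proof (rule cInf_lower)
  show "bdd_below {(\<Sum>r \<in> one_rectangles I J K. x r) | x. fractional_cover I J K x}"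
    \<comment> \<open>An infimum of reals is a lower bound only if the set is bounded below; weights
      of covers are nonnegative, so 0 serves.\<close>
    by (rule bdd_belowI[of _ 0]) (auto simp: fractional_cover_def intro!: sum_nonneg)
qed (use assms in blast)

text \<open>Each edge of a path from \<open>a\<close> to \<open>b\<close> is itself reachable from
  \<open>a\<close> and leads to \<open>b\<close>, so the restriction keeps the whole path. This is
  what lets edges be discarded without losing connections.\<close>

lemma rtrancl_restrict_on_path:
  assumes "(a, b) \<in> E\<^sup>*"
  shows "(a, b) \<in> {(u, v) \<in> E. (a, u) \<in> E\<^sup>* \<and> (v, b) \<in> E\<^sup>*}\<^sup>*" (is "_ \<in> ?P\<^sup>*")
proof -
  \<comment> \<open>Induction on the prefix ending in \<open>w\<close>, with the target
    \<open>b\<close> kept fixed, since \<open>?P\<close> depends on it.\<close>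
  have "(a, w) \<in> ?P\<^sup>*" if "(a, w) \<in> E\<^sup>*" "(w, b) \<in> E\<^sup>*" for w
    using that
  proof (induction rule: rtrancl_induct)
    case (step y z)
    then have "(a, y) \<in> ?P\<^sup>*" "(y, z) \<in> ?P" by (auto intro: converse_rtrancl_into_rtrancl)
    then show ?case by (rule rtrancl_into_rtrancl)
  qed simp
  with assms show ?thesis by blast
qed

text \<open>The linear programming half, free of networks. Rectangles are indexed by
  \<open>E\<close>, so one induced by several indices is counted with multiplicity.\<close>

lemma fractional_rank_le_family:
  fixes c :: nat
  assumes fin: "finite I" "finite J" "finite E" and "c > 0"
    and rect: "\<And>e. e \<in> E \<Longrightarrow> (R e, C e) \<in> one_rectangles I J K"
    and cover: "\<And>i j. i \<in> I \<Longrightarrow> j \<in> J \<Longrightarrow> K i j \<Longrightarrow> c \<le> card {e \<in> E. i \<in> R e \<and> j \<in> C e}"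
  shows "fractional_rank I J K * real c \<le> real (card E)"
proof -
  let ?\<R> = "one_rectangles I J K"
  define n where "n r = card {e \<in> E. (R e, C e) = r}" for r
  \<comment> \<open>Covers are required to take values in \<open>[0, 1]\<close>, hence the truncation.\<close>
  define x where "x r = min 1 (real (n r) / real c)" for r
  have fin\<R>: "finite ?\<R>" using fin by (simp add: finite_one_rectangles)
  \<comment> \<open>Double counting over the fibres of the map from indices to rectangles; used for
    the rectangles through one entry and for all of them.\<close>
  have card_fibres: "card {e \<in> E. (R e, C e) \<in> S} = sum n S" if "finite S" for S
  proof -
    have "{e \<in> E. (R e, C e) \<in> S} = (\<Union>r\<in>S. {e \<in> E. (R e, C e) = r})" by auto
    also have "card \<dots> = sum n S"
      unfolding n_def by (rule card_UN_disjoint) (use that fin in auto)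
    finally show ?thesis .
  qed
  have "fractional_cover I J K x"
    unfolding fractional_cover_def
  proof (intro conjI ballI impI)
    fix i j assume ij: "i \<in> I" "j \<in> J" "K i j"
    let ?S = "{(R, C) \<in> ?\<R>. i \<in> R \<and> j \<in> C}"
    have finS: "finite ?S" by (rule finite_subset[OF _ fin\<R>]) auto
    have nonneg: "0 \<le> x r" for r by (simp add: x_def)
    show "1 \<le> sum x ?S"
    \<comment> \<open>A rectangle of weight 1 covers the entry alone; if there is none, no weight in
      the sum was truncated.\<close>
    proof (cases "\<exists>r\<in>?S. x r = 1")
      case True
      then obtain r where "r \<in> ?S" "x r = 1" by blast
      then show ?thesis using member_le_sum[of r ?S x] nonneg finS by simp
    next
      case False
      have "c \<le> card {e \<in> E. i \<in> R e \<and> j \<in> C e}" using cover ij by blast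
      also have "{e \<in> E. i \<in> R e \<and> j \<in> C e} = {e \<in> E. (R e, C e) \<in> ?S}" using rect by auto
      also have "card \<dots> = sum n ?S" by (rule card_fibres[OF finS])
      finally have "real c \<le> (\<Sum>r\<in>?S. real (n r))" by (simp flip: of_nat_sum)
      then have "1 \<le> (\<Sum>r\<in>?S. real (n r)) / real c" using \<open>c > 0\<close> by simp
      also have "\<dots> = (\<Sum>r\<in>?S. real (n r) / real c)" by (rule sum_divide_distrib)
      also have "\<dots> = sum x ?S"
      proof (rule sum.cong)
        fix r assume "r \<in> ?S"
        then have "x r \<noteq> 1" using False by blast
        then show "real (n r) / real c = x r" by (simp add: x_def min_def split: if_split_asm)
      qed simp
      finally show ?thesis .
    qed
  qed (simp_all add: x_def)
  then have "fractional_rank I J K \<le> sum x ?\<R>" by (rule fractional_rank_le)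
  also have "\<dots> \<le> (\<Sum>r\<in>?\<R>. real (n r) / real c)" by (rule sum_mono) (simp add: x_def)
  also have "\<dots> = real (sum n ?\<R>) / real c" by (simp add: sum_divide_distrib)
  also have "sum n ?\<R> = card {e \<in> E. (R e, C e) \<in> ?\<R>}" using card_fibres[OF fin\<R>] by simp
  also have "{e \<in> E. (R e, C e) \<in> ?\<R>} = E" using rect by blast
  finally show ?thesis using \<open>c > 0\<close> by (simp add: pos_le_divide_eq)
qed

lemma fractional_rank_mult_OR_complexity_le:
  assumes fin: "finite I\<^sub>1" "finite J\<^sub>1" "finite I\<^sub>2" "finite J\<^sub>2"
  shows "fractional_rank I\<^sub>1 J\<^sub>1 K * real (OR_complexity I\<^sub>2 J\<^sub>2 M)
    \<le> real (OR_complexity (I\<^sub>1 \<times> I\<^sub>2) (J\<^sub>1 \<times> J\<^sub>2) (kronecker K M))"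
\<comment> \<open>The weights are divided by this number; if it is 0, the left side
  vanishes.\<close>
proof (cases "OR_complexity I\<^sub>2 J\<^sub>2 M = 0")
  case False
  obtain V :: "nat set" and E inp out
    where net: "rectifier_network (I\<^sub>1 \<times> I\<^sub>2) (J\<^sub>1 \<times> J\<^sub>2) V E inp out"
      and expr: "expresses (I\<^sub>1 \<times> I\<^sub>2) (J\<^sub>1 \<times> J\<^sub>2) E inp out (kronecker K M)"
      and size: "OR_complexity (I\<^sub>1 \<times> I\<^sub>2) (J\<^sub>1 \<times> J\<^sub>2) (kronecker K M) = card E"
    using OR_complexity_attained[of "I\<^sub>1 \<times> I\<^sub>2" "J\<^sub>1 \<times> J\<^sub>2" "kronecker K M"] fin by auto
  have "finite V" "E \<subseteq> V \<times> V" using net by (auto simp: rectifier_network_def)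
  then have "finite E" by (meson finite_SigmaI finite_subset)
  have path_iff: "(inp (j\<^sub>1, j\<^sub>2), out (i\<^sub>1, i\<^sub>2)) \<in> E\<^sup>* \<longleftrightarrow> K i\<^sub>1 j\<^sub>1 \<and> M i\<^sub>2 j\<^sub>2"
    if "i\<^sub>1 \<in> I\<^sub>1" "i\<^sub>2 \<in> I\<^sub>2" "j\<^sub>1 \<in> J\<^sub>1" "j\<^sub>2 \<in> J\<^sub>2" for i\<^sub>1 i\<^sub>2 j\<^sub>1 j\<^sub>2
    using expr that unfolding expresses_def kronecker_def by fastforce
  \<comment> \<open>The second indices may be arbitrary: whichever input and output are joined
    through \<open>e\<close>, their Kronecker entry is 1, which forces the entry of \<open>K\<close>
    to be 1.\<close>
  define R where "R e = {i\<^sub>1 \<in> I\<^sub>1. \<exists>i\<^sub>2\<in>I\<^sub>2. (snd e, out (i\<^sub>1, i\<^sub>2)) \<in> E\<^sup>*}" for e :: "nat \<times> nat"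
  define C where "C e = {j\<^sub>1 \<in> J\<^sub>1. \<exists>j\<^sub>2\<in>J\<^sub>2. (inp (j\<^sub>1, j\<^sub>2), fst e) \<in> E\<^sup>*}" for e :: "nat \<times> nat"
  have rect: "(R e, C e) \<in> one_rectangles I\<^sub>1 J\<^sub>1 K" if "e \<in> E" for e
  proof -
    have "K i\<^sub>1 j\<^sub>1" if i: "i\<^sub>1 \<in> R e" and j: "j\<^sub>1 \<in> C e" for i\<^sub>1 j\<^sub>1
    proof -
      obtain i\<^sub>2 where i2: "i\<^sub>2 \<in> I\<^sub>2" "(snd e, out (i\<^sub>1, i\<^sub>2)) \<in> E\<^sup>*" using i by (auto simp: R_def)
      obtain j\<^sub>2 where j2: "j\<^sub>2 \<in> J\<^sub>2" "(inp (j\<^sub>1, j\<^sub>2), fst e) \<in> E\<^sup>*" using j by (auto simp: C_def)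
      have "(fst e, snd e) \<in> E" using \<open>e \<in> E\<close> by simp
      with i2 j2 have "(inp (j\<^sub>1, j\<^sub>2), out (i\<^sub>1, i\<^sub>2)) \<in> E\<^sup>*"
        by (meson rtrancl_into_rtrancl rtrancl_trans)
      with i2 j2 i j show ?thesis by (auto simp: path_iff R_def C_def)
    qed
    then show ?thesis by (auto simp: one_rectangles_def R_def C_def)
  qed
  have cover: "OR_complexity I\<^sub>2 J\<^sub>2 M \<le> card {e \<in> E. i\<^sub>1 \<in> R e \<and> j\<^sub>1 \<in> C e}"
    if ij: "i\<^sub>1 \<in> I\<^sub>1" "j\<^sub>1 \<in> J\<^sub>1" "K i\<^sub>1 j\<^sub>1" for i\<^sub>1 j\<^sub>1
  proof -
    let ?E = "{e \<in> E. i\<^sub>1 \<in> R e \<and> j\<^sub>1 \<in> C e}"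
    let ?inp = "\<lambda>j\<^sub>2. inp (j\<^sub>1, j\<^sub>2)" and ?out = "\<lambda>i\<^sub>2. out (i\<^sub>1, i\<^sub>2)"
    \<comment> \<open>Deleting edges preserves acyclicity, sources and sinks, so \<open>V\<close>
      can stay as it is.\<close>
    have "acyclic ?E" using net by (auto simp: rectifier_network_def intro: acyclic_subset)
    moreover have "inj_on ?inp J\<^sub>2" "inj_on ?out I\<^sub>2"
      using net ij by (auto simp: rectifier_network_def inj_on_def)
    moreover have "?inp ` J\<^sub>2 \<subseteq> V - Range ?E" "?out ` I\<^sub>2 \<subseteq> V - Domain ?E"
      using net ij unfolding rectifier_network_def by blast+
    ultimately have "rectifier_network I\<^sub>2 J\<^sub>2 V ?E ?inp ?out"
      unfolding rectifier_network_def using \<open>finite V\<close> \<open>E \<subseteq> V \<times> V\<close> by blast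
    moreover have "expresses I\<^sub>2 J\<^sub>2 ?E ?inp ?out M"
      unfolding expresses_def
    proof (intro ballI)
      fix i\<^sub>2 j\<^sub>2 assume ij2: "i\<^sub>2 \<in> I\<^sub>2" "j\<^sub>2 \<in> J\<^sub>2"
      \<comment> \<open>The given \<open>i\<^sub>2\<close> and \<open>j\<^sub>2\<close> witness the
        existentials in \<open>R\<close> and \<open>C\<close>.\<close>
      have sub: "{(u, v) \<in> E. (?inp j\<^sub>2, u) \<in> E\<^sup>* \<and> (v, ?out i\<^sub>2) \<in> E\<^sup>*} \<subseteq> ?E"
        using ij ij2 by (auto simp: R_def C_def)
      have "(?inp j\<^sub>2, ?out i\<^sub>2) \<in> ?E\<^sup>* \<longleftrightarrow> (?inp j\<^sub>2, ?out i\<^sub>2) \<in> E\<^sup>*"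
      proof
        show "(?inp j\<^sub>2, ?out i\<^sub>2) \<in> E\<^sup>*" if "(?inp j\<^sub>2, ?out i\<^sub>2) \<in> ?E\<^sup>*"
          using rtrancl_mono[of ?E E] that by blast
        show "(?inp j\<^sub>2, ?out i\<^sub>2) \<in> ?E\<^sup>*" if "(?inp j\<^sub>2, ?out i\<^sub>2) \<in> E\<^sup>*"
          using rtrancl_restrict_on_path[OF that] rtrancl_mono[OF sub] by blast
      qed
      \<comment> \<open>Since \<open>K i\<^sub>1 j\<^sub>1\<close> holds, the Kronecker entry
        reduces to that of \<open>M\<close>.\<close>
      then show "M i\<^sub>2 j\<^sub>2 \<longleftrightarrow> (?inp j\<^sub>2, ?out i\<^sub>2) \<in> ?E\<^sup>*" using path_iff ij ij2 by simp
    qed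
    ultimately show ?thesis by (rule OR_complexity_le_card)
  qed
  show ?thesis
    unfolding size
    by (rule fractional_rank_le_family[OF fin(1,2) \<open>finite E\<close> _ rect cover]) (use False in simp_all)
qed simp

theorem theorem12:
  fixes m1 n1 m2 n2 :: nat and K M :: "nat \<Rightarrow> nat \<Rightarrow> bool"
  shows "real (OR_complexity ({1..m1} \<times> {1..m2}) ({1..n1} \<times> {1..n2}) (kronecker K M))
    \<ge> fractional_rank {1..m1} {1..n1} K * real (OR_complexity {1..m2} {1..n2} M)"
  by (rule fractional_rank_mult_OR_complexity_le) simp_all

end
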